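(* Let $G_S$ and $G_T$ be two parallel straight lines in $\mathbb{R}^2$. Let $L$ be a third straight line that is not parallel to $G_S$ and $G_T$ and does not contain the origin $(0,0)$. Let $S=(x_S,y_S)$ be the intersection point of $L$ with $G_S$, and $T=(x_T,y_T)$ the intersection point of $L$ with $G_T$. Let $Z_S$ be the straight line through $(0,0)$ and $S$, and $Z_T$ the straight line through $(0,0)$ and $T$. If $G_S$ and $G_T$ are distinct, then $(0,0),S,T$ are not collinear, and $Z_S\neq Z_T$. Moreover: (A) Suppose $G_S$ and $G_T$ are not parallel to the horizontal $x$-axis, and let $(a_S,0)$ and $(a_T,0)$ be the intersection points of $G_S$ and $G_T$, respectively, with the $x$-axis. Then there is a unique point $P_{hor}=(x_{hor},y_{hor})$ on $L$ such that $$(x_{hor}-a_S,\;y_{hor})\in Z_T\quad\text{and}\quad (x_{hor}-a_T,\;y_{hor})\in Z_S .$$ (B) Suppose $G_S$ and $G_T$ are not parallel to the vertical $y$-axis, and let $(0,b_S)$ and $(0,b_T)$ be the intersection points of $G_S$ and $G_T$, respectively, with the $y$-axis. Then there is a unique point $P_{ver}=(x_{ver},y_{ver})$ on $L$ such that $$(x_{ver},\;y_{ver}-b_S)\in Z_T\quad\text{and}\quad (x_{ver},\;y_{ver}-b_T)\in Z_S .$$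
   Context: $\mathbb{R}^2$ is the Euclidean plane with horizontal $x$-axis and vertical $y$-axis. Parallel lines are allowed to coincide (every line is parallel to itself); in particular $G_S=G_T$ is allowed. Cases (A) and (B) are not mutually exclusive. *)

theory Defs
  imports "HOL-Analysis.Analysis"
begin

text \<open>
  The plane is \<^typ>\<open>real \<times> real\<close>, whose norm and inner product in the library are Euclidean.
  Parallelism is \<^const>\<open>affine_parallel\<close> (one set is a translate of the other); for straight lines
  this is the usual notion, under which every line is parallel to itself.
\<close>

definition straight_line :: "(real \<times> real) set \<Rightarrow> bool" where
  "straight_line G \<longleftrightarrow> affine G \<and> aff_dim G = 1"

definition x_axis :: "(real \<times> real) set" where
  "x_axis = {p. snd p = 0}"

definition y_axis :: "(real \<times> real) set" where
  "y_axis = {p. fst p = 0}"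

end

theory Submission
  imports Defs
begin

text \<open>
  Write \<open>[p, q]\<close> for the determinant of two plane vectors. A line of direction \<open>u\<close> is a level set of
  \<open>p \<mapsto> [p, u]\<close>, so all the incidences in question are equations between determinants. Let \<open>A\<close> and
  \<open>B\<close> be the points at which \<open>G\<^sub>S\<close> and \<open>G\<^sub>T\<close> meet the coordinate axis. The point sought on \<open>L\<close> has to
  satisfy \<open>[P, T] = [A, T]\<close> and \<open>[P, S] = [B, S]\<close>.

  If \<open>S \<noteq> T\<close>, then \<open>[S, T] \<noteq> 0\<close> because \<open>L\<close> misses the origin, and these two equations alone
  determine \<open>P\<close>. That this \<open>P\<close> lies on \<open>L\<close>, the line joining \<open>S\<close> and \<open>T\<close>, amounts to
  \<open>[A, T] - [B, S] = [S, T]\<close>. This holds for two reasons: \<open>A - S\<close> and \<open>B - T\<close> both point in the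
  common direction of \<open>G\<^sub>S\<close> and \<open>G\<^sub>T\<close>, so \<open>[A - S, B - T] = 0\<close>; and \<open>A\<close> and \<open>B\<close> lie on one line
  through the origin, so \<open>[A, B] = 0\<close>. Expanding the first determinant and inserting the second gives
  the identity.

  If \<open>S = T\<close>, then \<open>G\<^sub>S = G\<^sub>T\<close>, so \<open>A = B\<close>, and the two equations become one: \<open>P\<close> is the point where
  \<open>L\<close> meets the line through \<open>A\<close> in the direction of \<open>S\<close>. That direction is not parallel to \<open>L\<close>,
  again because \<open>L\<close> misses the origin.

  Both axes enter only as lines through the origin not parallel to \<open>G\<^sub>S\<close>, so the lemma
  \<open>unique_point_on_transversal\<close> covers cases (A) and (B) at once.
\<close>

definition cross :: "real \<times> real \<Rightarrow> real \<times> real \<Rightarrow> real" where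
  "cross p q = fst p * snd q - snd p * fst q"

lemma cross_add_left: "cross (p + q) r = cross p r + cross q r"
  and cross_diff_left: "cross (p - q) r = cross p r - cross q r"
  and cross_diff_right: "cross r (p - q) = cross r p - cross r q"
  and cross_scaleR_left: "cross (k *\<^sub>R p) r = k * cross p r"
  and cross_scaleR_right: "cross r (k *\<^sub>R p) = k * cross r p"
  and cross_self: "cross p p = 0"
  and cross_zero: "cross 0 p = 0" "cross p 0 = 0"
  by (simp_all add: cross_def algebra_simps)

lemma cross_swap: "cross p q = - cross q p"
  by (simp add: cross_def)

text \<open>
  Three plane vectors are linearly dependent, and these are the coefficients. In particular, a vector
  is determined by its determinants with two independent ones, which is how uniqueness is shown.
\<close>

lemma cross_relation: "cross q r *\<^sub>R p = cross p r *\<^sub>R q - cross p q *\<^sub>R r"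
  by (simp add: prod_eq_iff cross_def algebra_simps)

lemma cross_eq_0_iff:
  assumes "q \<noteq> 0"
  shows "cross p q = 0 \<longleftrightarrow> (\<exists>k. p = k *\<^sub>R q)"
proof
  assume 0: "cross p q = 0"
  from assms have "fst q \<noteq> 0 \<or> snd q \<noteq> 0"
    by (simp add: prod_eq_iff)
  then show "\<exists>k. p = k *\<^sub>R q"
  proof
    assume "fst q \<noteq> 0"
    with 0 have "p = (fst p / fst q) *\<^sub>R q"
      by (simp add: prod_eq_iff cross_def field_simps)
    then show ?thesis ..
  next
    assume "snd q \<noteq> 0"
    with 0 have "p = (snd p / snd q) *\<^sub>R q"
      by (simp add: prod_eq_iff cross_def field_simps)
    then show ?thesis ..
  qed
qed (auto simp: cross_scaleR_left cross_self)

lemma eq_if_cross_eq: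
  assumes "cross p q = cross p' q" "cross p r = cross p' r" "cross q r \<noteq> 0"
  shows "p = p'"
proof -
  have "cross q r *\<^sub>R p = cross q r *\<^sub>R p'"
    unfolding cross_relation[of q r] using assms by simp
  with assms(3) show ?thesis
    by simp
qed

lemma cross_eq_0_trans:
  assumes "cross p g = 0" "cross q g = 0" "g \<noteq> 0"
  shows "cross p q = 0"
  using assms by (auto simp: cross_eq_0_iff cross_scaleR_left cross_scaleR_right cross_self)

text \<open>
  The parallel through the origin is a one-dimensional subspace, spanned by \<open>u\<close> say, and hence the
  kernel of \<open>[_, u]\<close>; the line is a translate of it.
\<close>

lemma straight_line_cross:
  assumes "straight_line G"
  obtains u c where "u \<noteq> 0" "G = {x. cross x u = c}"
proof -
  from assms have aff: "affine G" and dim: "aff_dim G = 1"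
    by (auto simp: straight_line_def)
  from dim have "G \<noteq> {}"
    by auto
  obtain V where V: "subspace V" "affine_parallel G V"
    using affine_parallel_subspace[OF aff \<open>G \<noteq> {}\<close>] by (elim ex1E conjE)
  have "dim V = 1"
    using aff_dim_parallel_subspace[OF \<open>G \<noteq> {}\<close>] V dim aff
    by (simp add: hull_same)
  obtain B where "B \<subseteq> V" "independent B" "V \<subseteq> span B" "card B = dim V"
    by (rule basis_exists)
  moreover from this \<open>dim V = 1\<close> obtain u where "B = {u}"
    by (auto simp: card_1_singleton_iff)
  ultimately have u: "u \<noteq> 0" "V = span {u}"
    using V(1) span_minimal[of "{u}" V] by auto
  from V obtain a where a: "V = (+) a ` G"
    by (auto simp: affine_parallel_def)
  have mem: "x \<in> G \<longleftrightarrow> cross x u = - cross a u" for x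
  proof -
    have "x \<in> G \<longleftrightarrow> a + x \<in> V"
      unfolding a by auto
    also have "\<dots> \<longleftrightarrow> cross (a + x) u = 0"
      by (auto simp: u(2) span_singleton cross_eq_0_iff[OF u(1)])
    finally show ?thesis
      by (auto simp: cross_add_left)
  qed
  show thesis
    by (rule that[OF u(1), of "- cross a u"]) (use mem in auto)
qed

lemma translation_cross_level_set:
  "(+) a ` {x. cross x u = c} = {x. cross x u = c + cross a u}"
proof -
  have "x \<in> (+) a ` {x. cross x u = c} \<longleftrightarrow> x - a \<in> {x. cross x u = c}" for x
    by force
  then show ?thesis
    by (simp add: set_eq_iff cross_diff_left diff_eq_eq)
qed

text \<open>
  This turns the hypothesis that a line is not parallel to an axis into a determinant that does not
  vanish.
\<close>

lemma affine_parallel_cross_level_sets: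
  assumes "u \<noteq> 0" "v \<noteq> 0" "cross u v = 0"
  shows "affine_parallel {x. cross x u = c} {x. cross x v = d}"
proof -
  obtain k where k: "u = k *\<^sub>R v"
    using assms by (auto simp: cross_eq_0_iff)
  with assms have "k \<noteq> 0"
    by auto
  with k have level: "{x. cross x u = c} = {x. cross x v = c / k}"
    by (auto simp: cross_scaleR_right field_simps)
  \<comment> \<open>The quarter turn \<open>w\<close> of \<open>v\<close> satisfies \<open>[w, v] = |v|\<^sup>2\<close>, so its multiples reach every level.\<close>
  define w where "w = (snd v, - fst v)"
  have "cross w v \<noteq> 0"
    using \<open>v \<noteq> 0\<close> by (auto simp: w_def cross_def prod_eq_iff)
  then have "cross (((d - c / k) / cross w v) *\<^sub>R w) v = d - c / k"
    by (simp add: cross_scaleR_left)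
  then have "{x. cross x v = d} = (+) (((d - c / k) / cross w v) *\<^sub>R w) ` {x. cross x u = c}"
    unfolding level translation_cross_level_set by simp
  then show ?thesis
    unfolding affine_parallel_def by blast
qed

lemma affine_hull_origin:
  assumes "q \<noteq> 0"
  shows "affine hull {(0, 0), q} = {x. cross x q = 0}"
proof -
  have "affine hull {(0, 0), q} = span {q}"
    unfolding zero_prod_def[symmetric]
    by (subst affine_hull_span_0) (auto simp: hull_inc)
  also have "\<dots> = {x. cross x q = 0}"
    using assms by (auto simp: span_singleton cross_eq_0_iff)
  finally show ?thesis .
qed

text \<open>
  If \<open>T = k S\<close>, then applying \<open>[_, u]\<close> gives \<open>c = k c\<close>, so \<open>k = 1\<close>; here \<open>c \<noteq> 0\<close> expresses that the
  line through \<open>S\<close> and \<open>T\<close> misses the origin.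
\<close>

lemma cross_neq_0_if_line_misses_origin:
  assumes "cross S u = c" "cross T u = c" "c \<noteq> 0" "S \<noteq> T"
  shows "cross S T \<noteq> 0"
proof
  assume "cross S T = 0"
  with cross_relation[of T u S] assms have "c *\<^sub>R S = c *\<^sub>R T"
    by simp
  with assms show False
    by simp
qed

text \<open>
  Here \<open>u\<close> and \<open>g\<close> are the directions of \<open>L\<close> and of the two parallels, and \<open>e\<close> is the direction of
  the line through the origin on which \<open>A\<close> and \<open>B\<close> lie.
\<close>

lemma unique_point_on_transversal:
  assumes L: "cross S u = c" "cross T u = c" "c \<noteq> 0"
    and g: "g \<noteq> 0" "cross A g = cross S g" "cross B g = cross T g"
    and e: "cross A e = 0" "cross B e = 0" "cross g e \<noteq> 0"
  shows "\<exists>!P. cross P u = c \<and> cross (P - A) T = 0 \<and> cross (P - B) S = 0"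
proof (cases "S = T")
  case True
  with g e have "A = B"
    using eq_if_cross_eq[of A g B e] by simp
  define P where "P = A + ((c - cross A u) / c) *\<^sub>R S"
  have "cross P u = c" "cross (P - A) S = 0"
    using L by (simp_all add: P_def cross_add_left cross_scaleR_left cross_self)
  moreover have "Q = P" if "cross Q u = c" "cross (Q - A) S = 0" for Q
    using that calculation L
    by (intro eq_if_cross_eq[of Q S P u]) (simp_all add: cross_diff_left)
  ultimately show ?thesis
    using True \<open>A = B\<close> by blast
next
  case False
  with L have ST: "cross S T \<noteq> 0"
    by (intro cross_neq_0_if_line_misses_origin)
  have "e \<noteq> 0"
    using e by (auto simp: cross_zero)
  with e have "cross A B = 0"
    by (simp add: cross_eq_0_trans[of A e B])
  moreover have "cross (A - S) (B - T) = 0"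
    using g by (simp add: cross_eq_0_trans[of "A - S" g "B - T"] cross_diff_left[of _ _ g])
  ultimately have key: "cross A T - cross B S = cross S T"
    using cross_swap[of S B] by (simp add: cross_diff_left cross_diff_right)
  \<comment> \<open>The solution, by Cramer's rule, of \<open>[P, T] = [A, T]\<close> and \<open>[P, S] = [B, S]\<close>.\<close>
  define P where "P = (1 / cross S T) *\<^sub>R (cross A T *\<^sub>R S - cross B S *\<^sub>R T)"
  have "cross P u = (cross A T - cross B S) * c / cross S T"
    using L by (simp add: P_def cross_diff_left cross_scaleR_left left_diff_distrib)
  with key ST have "cross P u = c"
    by simp
  moreover have "cross (P - A) T = 0"
    using ST by (simp add: P_def cross_diff_left cross_scaleR_left cross_self)
  moreover have "cross (P - B) S = 0"
    using ST cross_swap[of T S]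
    by (simp add: P_def cross_diff_left cross_scaleR_left cross_self)
  moreover have "Q = P" if "cross (Q - A) T = 0" "cross (Q - B) S = 0" for Q
    using that calculation ST
    by (intro eq_if_cross_eq[of Q S P T]) (simp_all add: cross_diff_left)
  ultimately show ?thesis
    by blast
qed

lemma x_axis_cross: "x_axis = {p. cross p (1, 0) = 0}"
  and y_axis_cross: "y_axis = {p. cross p (0, 1) = 0}"
  by (auto simp: x_axis_def y_axis_def cross_def)

theorem proposition1:
  fixes G\<^sub>S G\<^sub>T L Z\<^sub>S Z\<^sub>T :: "(real \<times> real) set"
    and S T :: "real \<times> real"
  assumes "straight_line G\<^sub>S" and "straight_line G\<^sub>T" and "straight_line L"
    and "affine_parallel G\<^sub>S G\<^sub>T"
    and "\<not> affine_parallel L G\<^sub>S" and "\<not> affine_parallel L G\<^sub>T"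
    and "(0, 0) \<notin> L"
    and "S \<in> L \<inter> G\<^sub>S" and "T \<in> L \<inter> G\<^sub>T"
    and "Z\<^sub>S = affine hull {(0, 0), S}" and "Z\<^sub>T = affine hull {(0, 0), T}"
  shows "(G\<^sub>S \<noteq> G\<^sub>T \<longrightarrow> \<not> collinear {(0, 0), S, T} \<and> Z\<^sub>S \<noteq> Z\<^sub>T)
    \<and> (\<not> affine_parallel G\<^sub>S x_axis \<and> \<not> affine_parallel G\<^sub>T x_axis \<longrightarrow>
        (\<forall>a\<^sub>S a\<^sub>T. (a\<^sub>S, 0) \<in> G\<^sub>S \<inter> x_axis \<and> (a\<^sub>T, 0) \<in> G\<^sub>T \<inter> x_axis \<longrightarrow>
          (\<exists>!P. P \<in> L \<and> (fst P - a\<^sub>S, snd P) \<in> Z\<^sub>T \<and> (fst P - a\<^sub>T, snd P) \<in> Z\<^sub>S)))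
    \<and> (\<not> affine_parallel G\<^sub>S y_axis \<and> \<not> affine_parallel G\<^sub>T y_axis \<longrightarrow>
        (\<forall>b\<^sub>S b\<^sub>T. (0, b\<^sub>S) \<in> G\<^sub>S \<inter> y_axis \<and> (0, b\<^sub>T) \<in> G\<^sub>T \<inter> y_axis \<longrightarrow>
          (\<exists>!P. P \<in> L \<and> (fst P, snd P - b\<^sub>S) \<in> Z\<^sub>T \<and> (fst P, snd P - b\<^sub>T) \<in> Z\<^sub>S)))"
proof -
  obtain u c where L: "L = {x. cross x u = c}"
    using straight_line_cross[OF assms(3)] by blast
  obtain g s where g: "g \<noteq> 0" and GS: "G\<^sub>S = {x. cross x g = s}"
    using assms(1) by (rule straight_line_cross)
  obtain t where GT: "G\<^sub>T = {x. cross x g = t}"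
    using assms(4) unfolding affine_parallel_def GS translation_cross_level_set by blast
  have "cross (0, 0) u = 0"
    by (simp add: cross_def)
  with assms(7) have c: "c \<noteq> 0"
    by (auto simp: L)
  have S: "cross S u = c" "cross S g = s" and T: "cross T u = c" "cross T g = t"
    using assms(8,9) by (auto simp: L GS GT)
  have nz: "S \<noteq> 0" "T \<noteq> 0"
    using S T c by (auto simp: cross_zero)
  have ZS: "Z\<^sub>S = {x. cross x S = 0}" and ZT: "Z\<^sub>T = {x. cross x T = 0}"
    using assms(10,11) nz by (simp_all only: affine_hull_origin not_False_eq_True)
  have general_position: "\<not> collinear {(0, 0), S, T} \<and> Z\<^sub>S \<noteq> Z\<^sub>T" if "G\<^sub>S \<noteq> G\<^sub>T"
  proof -
    have "S \<noteq> T"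
      using that S T by (auto simp: GS GT)
    with S T c have ST: "cross S T \<noteq> 0"
      by (intro cross_neq_0_if_line_misses_origin)
    then have "\<not> collinear {0, S, T}"
      using nz by (auto simp: collinear_lemma cross_scaleR_right cross_self)
    moreover have "S \<in> Z\<^sub>S" "S \<notin> Z\<^sub>T"
      using ST by (auto simp: ZS ZT cross_self)
    ultimately show ?thesis
      by (auto simp: zero_prod_def)
  qed
  have point: "\<exists>!P. P \<in> L \<and> P - A \<in> Z\<^sub>T \<and> P - B \<in> Z\<^sub>S"
    if "e \<noteq> 0" "\<not> affine_parallel G\<^sub>S {x. cross x e = 0}"
      "A \<in> G\<^sub>S" "cross A e = 0" "B \<in> G\<^sub>T" "cross B e = 0" for A B e
  proof -
    have "cross g e \<noteq> 0"
      using that(1,2) g affine_parallel_cross_level_sets unfolding GS by blast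
    with that show ?thesis
      unfolding L ZS ZT mem_Collect_eq
      using S T c g
      by (intro unique_point_on_transversal[of _ _ _ _ g _ _ e]) (auto simp: GS GT)
  qed
  have "\<exists>!P. P \<in> L \<and> (fst P - a\<^sub>S, snd P) \<in> Z\<^sub>T \<and> (fst P - a\<^sub>T, snd P) \<in> Z\<^sub>S"
    if "\<not> affine_parallel G\<^sub>S x_axis" "(a\<^sub>S, 0) \<in> G\<^sub>S" "(a\<^sub>T, 0) \<in> G\<^sub>T" for a\<^sub>S a\<^sub>T
  proof -
    have "P - (a, 0) = (fst P - a, snd P)" for P :: "real \<times> real" and a
      by (simp add: prod_eq_iff)
    with point[of "(1, 0)" "(a\<^sub>S, 0)" "(a\<^sub>T, 0)"] that show ?thesis
      by (simp add: x_axis_cross) (simp add: cross_def zero_prod_def)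
  qed
  moreover have "\<exists>!P. P \<in> L \<and> (fst P, snd P - b\<^sub>S) \<in> Z\<^sub>T \<and> (fst P, snd P - b\<^sub>T) \<in> Z\<^sub>S"
    if "\<not> affine_parallel G\<^sub>S y_axis" "(0, b\<^sub>S) \<in> G\<^sub>S" "(0, b\<^sub>T) \<in> G\<^sub>T" for b\<^sub>S b\<^sub>T
  proof -
    have "P - (0, b) = (fst P, snd P - b)" for P :: "real \<times> real" and b
      by (simp add: prod_eq_iff)
    with point[of "(0, 1)" "(0, b\<^sub>S)" "(0, b\<^sub>T)"] that show ?thesis
      by (simp add: y_axis_cross) (simp add: cross_def zero_prod_def)
  qed
  ultimately show ?thesis
    using general_position by blast
qed

end
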